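(* If a block $\Pi$ is refutable in $\mathsf{BT}^{i}$, then $\Pi$ is not realizable.
   Context: Formulae are generated from a countable set $\mathit{Var}$ of propositional variables by $A ::= p \mid \bot \mid A\land A \mid A\lor A \mid A\to A$. A Kripke model is $\mathcal M=(W,\le,V)$ with $W$ non-empty, $\le$ a preorder on $W$, and $V\colon W\to\mathcal P(\mathit{Var})$ monotone ($w\le v$ implies $V(w)\subseteq V(v)$). Forcing: $w\Vdash p$ iff $p\in V(w)$; never $w\Vdash\bot$; $w\Vdash A\land B$ iff $w\Vdash A$ and $w\Vdash B$; $w\Vdash A\lor B$ iff $w\Vdash A$ or $w\Vdash B$; $w\Vdash A\to B$ iff for every $v\ge w$, $v\Vdash A$ implies $v\Vdash B$. Blocks. A signed formula is $\mathsf{T}A$ or $\mathsf{F}A$; a block is a finite set $\Pi$ of signed formulae; $\Pi^{\mathsf{T}}=\{\mathsf{T}A:\mathsf{T}A\in\Pi\}$. A block $\Pi$ is realized at a world $w$ of a Kripke model if $w\Vdash A$ for every $\mathsf{T}A\in\Pi$ and $w\nVdash B$ for every $\mathsf{F}B\in\Pi$; it is realizable if it is realized at some world of some model. The calculus $\mathsf{BT}^{i}$. A block is closed if it contains $\mathsf{T}p$ and $\mathsf{F}p$ for some propositional variable $p$, or contains $\mathsf{T}\bot$. The rules pass from a block (context $\Pi$ plus displayed principal formula, which is removed unless displayed again) to one or two children: - $\mathsf{T}\land$: from $\Pi,\mathsf{T}(A\land B)$ to $\Pi,\mathsf{T}A,\mathsf{T}B$. - $\mathsf{F}\lor$: from $\Pi,\mathsf{F}(A\lor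 B)$ to $\Pi,\mathsf{F}A,\mathsf{F}B$. - $\mathsf{T}\lor$: from $\Pi,\mathsf{T}(A\lor B)$ to two children $\Pi,\mathsf{T}A$ and $\Pi,\mathsf{T}B$. - $\mathsf{F}\land$: from $\Pi,\mathsf{F}(A\land B)$ to two children $\Pi,\mathsf{F}A$ and $\Pi,\mathsf{F}B$. - $\mathsf{T}\to$: from $\Pi,\mathsf{T}(A\to B)$ to two children $\Pi,\mathsf{T}(A\to B),\mathsf{F}A$ and $\Pi,\mathsf{T}B$. - $\mathsf{F}\to$: from $\Pi,\mathsf{F}(A\to B)$ to $\Pi^{\mathsf{T}},\mathsf{T}A,\mathsf{F}B$. A tableau for $\Pi$ is a finite tree rooted at $\Pi$ grown by these rules; it is closed if every leaf is a closed block. $\Pi$ is refutable if it has a closed tableau. *)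

theory Defs
  imports Main "HOL-Library.FSet"
begin

datatype 'v form =
    Var 'v
  | Bot
  | Conj "'v form" "'v form" (infixr \<open>\<^bold>\<and>\<close> 65)
  | Disj "'v form" "'v form" (infixr \<open>\<^bold>\<or>\<close> 60)
  | Impl "'v form" "'v form" (infixr \<open>\<^bold>\<rightarrow>\<close> 55)

record ('w, 'v) kripke =
  worlds :: "'w set"
  acc :: "('w \<times> 'w) set"
  val :: "'w \<Rightarrow> 'v set"

definition kripke_model :: "('w, 'v) kripke \<Rightarrow> bool" where
  "kripke_model M \<longleftrightarrow>
     worlds M \<noteq> {} \<and>
     preorder_on (worlds M) (acc M) \<and>
     (\<forall>w\<in>worlds M. \<forall>v\<in>worlds M. (w, v) \<in> acc M \<longrightarrow> val M w \<subseteq> val M v)"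

primrec forces :: "('w, 'v) kripke \<Rightarrow> 'w \<Rightarrow> 'v form \<Rightarrow> bool" where
  "forces M w (Var p) \<longleftrightarrow> p \<in> val M w"
| "forces M w Bot \<longleftrightarrow> False"
| "forces M w (A \<^bold>\<and> B) \<longleftrightarrow> forces M w A \<and> forces M w B"
| "forces M w (A \<^bold>\<or> B) \<longleftrightarrow> forces M w A \<or> forces M w B"
| "forces M w (A \<^bold>\<rightarrow> B) \<longleftrightarrow>
     (\<forall>v\<in>worlds M. (w, v) \<in> acc M \<longrightarrow> forces M v A \<longrightarrow> forces M v B)"

datatype 'v signed = T "'v form" | F "'v form"

type_synonym 'v block = "'v signed fset"

fun is_T :: "'v signed \<Rightarrow> bool" where
  "is_T (T A) \<longleftrightarrow> True"
| "is_T (F A) \<longleftrightarrow> False"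

definition T_part :: "'v block \<Rightarrow> 'v block" where
  "T_part \<Pi> = ffilter is_T \<Pi>"

definition realized_at :: "('w, 'v) kripke \<Rightarrow> 'w \<Rightarrow> 'v block \<Rightarrow> bool" where
  "realized_at M w \<Pi> \<longleftrightarrow>
     (\<forall>A. T A |\<in>| \<Pi> \<longrightarrow> forces M w A) \<and> (\<forall>B. F B |\<in>| \<Pi> \<longrightarrow> \<not> forces M w B)"

text \<open>HOL cannot quantify over types inside a formula, so the type containing the worlds is an
  explicit parameter. Non-realizability in the sense of arbitrary models is
  \<open>\<not> realizable TYPE('w) \<Pi>\<close> with \<open>'w\<close> a free, hence universally quantified, type variable.\<close>
definition realizable :: "'w itself \<Rightarrow> 'v block \<Rightarrow> bool" where
  "realizable (_ :: 'w itself) \<Pi> \<longleftrightarrow>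
     (\<exists>(M :: ('w, 'v) kripke) w. kripke_model M \<and> w \<in> worlds M \<and> realized_at M w \<Pi>)"

definition closed_block :: "'v block \<Rightarrow> bool" where
  "closed_block \<Pi> \<longleftrightarrow> (\<exists>p. T (Var p) |\<in>| \<Pi> \<and> F (Var p) |\<in>| \<Pi>) \<or> T Bot |\<in>| \<Pi>"

text \<open>\<open>bt_rule \<Gamma> \<Delta>s\<close>: one rule application takes the block \<open>\<Gamma>\<close> to the list of children \<open>\<Delta>s\<close>.
  Blocks are sets, so the side conditions \<open>\<notin>\<close> are what makes the principal formula
  disappear from the context \<open>\<Pi>\<close> unless the rule displays it again.\<close>
inductive bt_rule :: "'v block \<Rightarrow> 'v block list \<Rightarrow> bool" where
  T_Conj: "T (A \<^bold>\<and> B) |\<notin>| \<Pi> \<Longrightarrow>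
    bt_rule (finsert (T (A \<^bold>\<and> B)) \<Pi>) [finsert (T A) (finsert (T B) \<Pi>)]"
| F_Disj: "F (A \<^bold>\<or> B) |\<notin>| \<Pi> \<Longrightarrow>
    bt_rule (finsert (F (A \<^bold>\<or> B)) \<Pi>) [finsert (F A) (finsert (F B) \<Pi>)]"
| T_Disj: "T (A \<^bold>\<or> B) |\<notin>| \<Pi> \<Longrightarrow>
    bt_rule (finsert (T (A \<^bold>\<or> B)) \<Pi>) [finsert (T A) \<Pi>, finsert (T B) \<Pi>]"
| F_Conj: "F (A \<^bold>\<and> B) |\<notin>| \<Pi> \<Longrightarrow>
    bt_rule (finsert (F (A \<^bold>\<and> B)) \<Pi>) [finsert (F A) \<Pi>, finsert (F B) \<Pi>]"
| T_Impl: "T (A \<^bold>\<rightarrow> B) |\<notin>| \<Pi> \<Longrightarrow>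
    bt_rule (finsert (T (A \<^bold>\<rightarrow> B)) \<Pi>)
      [finsert (T (A \<^bold>\<rightarrow> B)) (finsert (F A) \<Pi>), finsert (T B) \<Pi>]"
| F_Impl: "F (A \<^bold>\<rightarrow> B) |\<notin>| \<Pi> \<Longrightarrow>
    bt_rule (finsert (F (A \<^bold>\<rightarrow> B)) \<Pi>) [finsert (T A) (finsert (F B) (T_part \<Pi>))]"

datatype 'v tree = Node (root_block: "'v block") (subtrees: "'v tree list")

inductive tableau :: "'v tree \<Rightarrow> bool" where
  leaf: "tableau (Node \<Pi> [])"
| step: "bt_rule \<Pi> (map root_block ts) \<Longrightarrow> \<forall>t\<in>set ts. tableau t \<Longrightarrow> tableau (Node \<Pi> ts)"

primrec leaves :: "'v tree \<Rightarrow> 'v block set" where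
  "leaves (Node \<Pi> ts) = (if ts = [] then {\<Pi>} else \<Union> (set (map leaves ts)))"

definition tableau_for :: "'v tree \<Rightarrow> 'v block \<Rightarrow> bool" where
  "tableau_for t \<Pi> \<longleftrightarrow> tableau t \<and> root_block t = \<Pi>"

definition closed_tableau :: "'v tree \<Rightarrow> bool" where
  "closed_tableau t \<longleftrightarrow> (\<forall>\<Delta>\<in>leaves t. closed_block \<Delta>)"

definition refutable :: "'v block \<Rightarrow> bool" where
  "refutable \<Pi> \<longleftrightarrow> (\<exists>t. tableau_for t \<Pi> \<and> closed_tableau t)"

end

theory Submission
  imports Defs
begin

text \<open>
  The rules preserve realizability: if the block of a node is realized at a world, then so is
  the block of one of its children, in the same model but possibly at a later world. The world
  has to change only for the implication rule with sign \<^const>\<open>F\<close>: refuting \<open>A \<^bold>\<rightarrow> B\<close> at \<open>w\<close>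
  provides a world above \<open>w\<close> that forces \<open>A\<close> and not \<open>B\<close>. Persistence of forcing carries the
  formulae signed \<^const>\<open>T\<close> to that world, whereas those signed \<^const>\<open>F\<close> may become forced
  there, which is why the rule discards them. In this way a realized root yields a branch of
  the tableau along which every block is realized, and the leaf at its end cannot be closed.
\<close>

lemma forces_persistent:
  assumes "kripke_model M" "w \<in> worlds M" "v \<in> worlds M" "(w, v) \<in> acc M"
    and "forces M w A"
  shows "forces M v A"
  using assms
proof (induction A)
  case (Var p)
  then show ?case by (auto simp: kripke_model_def)
next
  case (Impl A B)
  have "trans (acc M)"
    using \<open>kripke_model M\<close> by (simp add: kripke_model_def preorder_on_def)
  then have "(w, u) \<in> acc M" if "(v, u) \<in> acc M" for u
    using \<open>(w, v) \<in> acc M\<close> that by (rule transD)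
  then show ?case using Impl.prems by simp
qed auto

lemma realized_not_closed:
  assumes "realized_at M w \<Pi>"
  shows "\<not> closed_block \<Pi>"
proof
  assume "closed_block \<Pi>"
  then consider p where "T (Var p) |\<in>| \<Pi>" "F (Var p) |\<in>| \<Pi>" | "T Bot |\<in>| \<Pi>"
    by (auto simp: closed_block_def)
  then show False
  proof cases
    case 1
    then show ?thesis using assms unfolding realized_at_def by blast
  next
    case 2
    then have "forces M w Bot" using assms unfolding realized_at_def by blast
    then show ?thesis by simp
  qed
qed

lemma realized_at_finsert_T:
  "realized_at M w (finsert (T A) \<Pi>) \<longleftrightarrow> forces M w A \<and> realized_at M w \<Pi>"
  by (auto simp: realized_at_def)

lemma realized_at_finsert_F:
  "realized_at M w (finsert (F A) \<Pi>) \<longleftrightarrow> \<not> forces M w A \<and> realized_at M w \<Pi>"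
  by (auto simp: realized_at_def)

lemmas realized_at_finsert = realized_at_finsert_T realized_at_finsert_F

lemma realized_T_part_later:
  assumes "kripke_model M" "w \<in> worlds M" "v \<in> worlds M" "(w, v) \<in> acc M"
    and "realized_at M w \<Pi>"
  shows "realized_at M v (T_part \<Pi>)"
  using assms forces_persistent[OF assms(1-4)] by (auto simp: realized_at_def T_part_def)

text \<open>
  For every rule but the last, the child is realized at \<open>w\<close> itself by the truth conditions of the
  principal connective. Reflexivity enters for \<open>T (A \<^bold>\<rightarrow> B)\<close>, which constrains
  \<open>w\<close> only because \<open>w\<close> is one of the worlds above \<open>w\<close>.
\<close>

lemma bt_rule_preserves_realized:
  assumes rule: "bt_rule \<Pi> \<Delta>s"
    and model: "kripke_model M" and w: "w \<in> worlds M" and real: "realized_at M w \<Pi>"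
  shows "\<exists>\<Delta>\<in>set \<Delta>s. \<exists>v\<in>worlds M. realized_at M v \<Delta>"
  using rule real
proof cases
  case (T_Impl A B \<Gamma>)
  have "(w, w) \<in> acc M"
    using model w by (auto simp: kripke_model_def preorder_on_def refl_on_def)
  with w real T_Impl have "\<not> forces M w A \<or> forces M w B"
    by (auto simp: realized_at_finsert)
  with w real T_Impl show ?thesis
    by (auto simp: realized_at_finsert simp del: forces.simps)
next
  case (F_Impl A B \<Gamma>)
  then obtain v where "v \<in> worlds M" "(w, v) \<in> acc M" "forces M v A" "\<not> forces M v B"
      and "realized_at M w \<Gamma>"
    using real by (auto simp: realized_at_finsert)
  then show ?thesis
    using F_Impl realized_T_part_later[OF model w] by (auto simp: realized_at_finsert)
qed (use w in \<open>auto simp: realized_at_finsert\<close>)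

text \<open>
  Following a realized child at every rule application ends in a realized leaf. The world is
  generalized in the induction because the next child may be realized only at a later one.
\<close>

lemma tableau_has_realized_leaf:
  assumes "tableau t" "kripke_model M" "w \<in> worlds M" "realized_at M w (root_block t)"
  shows "\<exists>\<Delta>\<in>leaves t. \<exists>v\<in>worlds M. realized_at M v \<Delta>"
  using assms
proof (induction arbitrary: w rule: tableau.induct)
  case (leaf \<Pi>)
  then show ?case by auto
next
  case (step \<Pi> ts)
  then obtain t v where t: "t \<in> set ts" and "v \<in> worlds M" "realized_at M v (root_block t)"
    using bt_rule_preserves_realized[OF step.hyps, of M w] by auto
  then obtain \<Delta> where "\<Delta> \<in> leaves t" "\<exists>v\<in>worlds M. realized_at M v \<Delta>"
    using step.IH \<open>kripke_model M\<close> by blast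
  moreover have "\<Delta> \<in> leaves (Node \<Pi> ts)"
    using t \<open>\<Delta> \<in> leaves t\<close> by auto
  ultimately show ?case by blast
qed

theorem theorem5p2:
  fixes \<Pi> :: "'v::countable block"
  assumes "refutable \<Pi>"
  shows "\<not> realizable TYPE('w) \<Pi>"
proof
  obtain t where t: "tableau t" "root_block t = \<Pi>" "closed_tableau t"
    using assms by (auto simp: refutable_def tableau_for_def)
  assume "realizable TYPE('w) \<Pi>"
  then obtain M :: "('w, 'v) kripke" and w
    where "kripke_model M" "w \<in> worlds M" "realized_at M w \<Pi>"
    by (auto simp: realizable_def)
  then obtain \<Delta> v where "\<Delta> \<in> leaves t" "realized_at M v \<Delta>"
    using tableau_has_realized_leaf[of t M w] t(1,2) by auto
  moreover have "closed_block \<Delta>"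
    using \<open>\<Delta> \<in> leaves t\<close> t(3) by (simp add: closed_tableau_def)
  ultimately show False
    using realized_not_closed[of M v \<Delta>] by simp
qed

end
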